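(* Let $p\in[1,\infty]$, $p^{-1}+q^{-1}=1$, and assume $\max\{\|f\|_p,\|f_1\|_p,\dots,\|f_N\|_p\}=:L<\infty$. Let $$\Psi=\widehat\Psi_{I_N}:=\Big\{\psi_g(\cdot)=\frac{\|g\|_p}{\|g\|_2^2}\,g(\cdot)\ :\ g=f_i-f_j,\ i,j\in I_N,\ i\ne j\Big\},$$ let $\varkappa:=\min\{\varkappa>0:\mathbb{P}[\max_{\psi\in\Psi}|Z(\psi)|/\|\psi\|_2\ge\varkappa]\le\varepsilon\}$, and let $\hat f=f_{\hat i}$ with $$\hat i:=\arg\min_{i\in I_N}\hat M_i,\qquad \hat M_i:=\max_{\psi\in\Psi}\Big\{\frac{1}{\|\psi\|_q}\big[|\Delta_i(\psi)|-\varepsilon\varkappa\|\psi\|_2\big]\Big\}.$$ Let $i_*:=\arg\min_{i\in I_N}\|f-f_i\|_p$. Then $$\mathcal{R}_p[\hat f;f]\le (2Q_2(p)+1)\min_{i\in I_N}\|f_i-f\|_p+2Q_3(p)\,\varepsilon\sqrt{2\ln\frac{N^2}{\varepsilon}}+2L\varepsilon,$$ where $$Q_2(p):=\max_{i\in I_N,\ i\neq i_*}\frac{\|f_{i_*}-f_i\|_p\,\|f_{i_*}-f_i\|_q}{\|f_{i_*}-f_i\|_2^2},\qquad Q_3(p):=\max_{i\in I_N,\ i\neq i_*}\frac{\|f_{i_*}-f_i\|_p}{\|f_{i_*}-f_i\|_2}.$$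
   Context: Model: $\mathcal{D}_0=[0,1]^d$, $\varepsilon\in(0,1)$, and one observes $\mathcal{Y}_\varepsilon$ in the Gaussian white noise model $Y_\varepsilon(dt)=f(t)\,dt+\varepsilon W(dt)$, $t\in\mathcal{D}_0$, with $f$ an unknown real function and $W$ the standard Wiener process in $\mathbb{R}^d$. Thus for a probe function $\psi\in\mathbb{L}_2(\mathcal{D}_0)$ one observes $\int\psi(t)Y_\varepsilon(dt)=\int\psi f\,dt+\varepsilon Z(\psi)$, where $Z(\psi)=\int\psi(t)W(dt)$ is the zero-mean Gaussian process, linear in $\psi$, with $\mathbb{E}[Z(\psi)Z(\phi)]=\int\psi\phi\,dt$. $\|\cdot\|_p$ is the $\mathbb{L}_p$-norm on $\mathcal{D}_0$ (Lebesgue measure); the risk of an estimator $\tilde f$ is $\mathcal{R}_p[\tilde f;f]:=\mathbb{E}_f\|\tilde f-f\|_p$, with $\mathbb{E}_f$ the expectation under the model with signal $f$. Family: $I_N=\{1,\dots,N\}$, $N\ge2$, and $f_1,\dots,f_N$ are distinct fixed (nonrandom) functions on $\mathcal{D}_0$. For a probe function $\psi$, $\Delta_i(\psi):=\int\psi(t)Y_\varepsilon(dt)-\int\psi(t)f_i(t)\,dt=\int\psi(t)[f(t)-f_i(t)]\,dt+\varepsilon Z(\psi)$. Conventions: all integrals and norms appearing are finite; ties in $\arg\min$ are broken arbitrarily (measurably). *)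

theory Defs
  imports "HOL-Analysis.Analysis" "HOL-Probability.Probability"
begin

definition unit_cube :: "(real ^ 'd) measure" where
  "unit_cube = lebesgue_on {t. \<forall>i. 0 \<le> t $ i \<and> t $ i \<le> 1}"

(* Exponents live in ennreal, where inverse top = 0, so that conjugacy reads
   inverse p + inverse q = 1 for all p in [1, top]. *)

definition in_Lp :: "'a measure \<Rightarrow> ennreal \<Rightarrow> ('a \<Rightarrow> real) \<Rightarrow> bool" where
  "in_Lp M p g \<longleftrightarrow> g \<in> borel_measurable M \<and>
     (if p = top then esssup M (\<lambda>x. ereal \<bar>g x\<bar>) < \<infinity>
      else integrable M (\<lambda>x. \<bar>g x\<bar> powr enn2real p))"

(* Real-valued; only meaningful together with in_Lp M p g. *)
definition Lp_norm :: "'a measure \<Rightarrow> ennreal \<Rightarrow> ('a \<Rightarrow> real) \<Rightarrow> real" where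
  "Lp_norm M p g =
     (if p = top then real_of_ereal (esssup M (\<lambda>x. ereal \<bar>g x\<bar>))
      else (LINT x|M. \<bar>g x\<bar> powr enn2real p) powr (1 / enn2real p))"

(* Norm on [0,1]^d *)
abbreviation cube_norm :: "ennreal \<Rightarrow> (real ^ 'd \<Rightarrow> real) \<Rightarrow> real" where
  "cube_norm \<equiv> Lp_norm unit_cube"

(* Degenerate (constant) normal laws are allowed. *)
definition gaussian_rv :: "'w measure \<Rightarrow> ('w \<Rightarrow> real) \<Rightarrow> bool" where
  "gaussian_rv M X \<longleftrightarrow> X \<in> borel_measurable M \<and>
     (\<exists>\<mu>. (AE \<omega> in M. X \<omega> = \<mu>) \<or>
       (\<exists>\<sigma>>0. distributed M lborel X (\<lambda>x. ennreal (normal_density \<mu> \<sigma> x))))"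

definition gaussian_process :: "'w measure \<Rightarrow> 'i set \<Rightarrow> ('i \<Rightarrow> 'w \<Rightarrow> real) \<Rightarrow> bool" where
  "gaussian_process M T X \<longleftrightarrow>
     (\<forall>S c. finite S \<and> S \<subseteq> T \<longrightarrow> gaussian_rv M (\<lambda>\<omega>. \<Sum>t\<in>S. c t * X t \<omega>))"

(* Z \<psi> stands for the stochastic integral of \<psi> against the Wiener process on [0,1]^d,
   i.e. Z is the isonormal Gaussian process on L2([0,1]^d).  Like a stochastic integral,
   it is linear only up to null sets depending on the arguments. *)
locale white_noise = prob_space M
  for M :: "'w measure" and Z :: "(real ^ 'd \<Rightarrow> real) \<Rightarrow> 'w \<Rightarrow> real" +
  assumes gaussian: "gaussian_process M {\<psi>. in_Lp unit_cube 2 \<psi>} Z"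
    and mean_zero: "\<And>\<psi>. in_Lp unit_cube 2 \<psi> \<Longrightarrow> (LINT \<omega>|M. Z \<psi> \<omega>) = 0"
    and covariance: "\<And>\<psi> \<phi>. in_Lp unit_cube 2 \<psi> \<Longrightarrow> in_Lp unit_cube 2 \<phi> \<Longrightarrow>
      (LINT \<omega>|M. Z \<psi> \<omega> * Z \<phi> \<omega>) = (LINT t|unit_cube. \<psi> t * \<phi> t)"
    and linear: "\<And>\<psi> \<phi> a b. in_Lp unit_cube 2 \<psi> \<Longrightarrow> in_Lp unit_cube 2 \<phi> \<Longrightarrow>
      (AE \<omega> in M. Z (\<lambda>t. a * \<psi> t + b * \<phi> t) \<omega> = a * Z \<psi> \<omega> + b * Z \<phi> \<omega>)"

(* The observation of the integral of \<psi> against Y(dt) = f(t) dt + \<epsilon> W(dt) *)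
definition observation ::
  "((real ^ 'd \<Rightarrow> real) \<Rightarrow> 'w \<Rightarrow> real) \<Rightarrow> real \<Rightarrow> (real ^ 'd \<Rightarrow> real) \<Rightarrow>
   (real ^ 'd \<Rightarrow> real) \<Rightarrow> 'w \<Rightarrow> real" where
  "observation Z \<epsilon> f \<psi> \<omega> = (LINT t|unit_cube. \<psi> t * f t) + \<epsilon> * Z \<psi> \<omega>"

(* Y is the observed process, h a candidate signal. *)
definition Delta ::
  "((real ^ 'd \<Rightarrow> real) \<Rightarrow> 'w \<Rightarrow> real) \<Rightarrow> (real ^ 'd \<Rightarrow> real) \<Rightarrow>
   (real ^ 'd \<Rightarrow> real) \<Rightarrow> 'w \<Rightarrow> real" where
  "Delta Y h \<psi> \<omega> = Y \<psi> \<omega> - (LINT t|unit_cube. \<psi> t * h t)"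

definition probe :: "ennreal \<Rightarrow> (real ^ 'd \<Rightarrow> real) \<Rightarrow> real ^ 'd \<Rightarrow> real" where
  "probe p g = (\<lambda>t. cube_norm p g / (cube_norm 2 g)\<^sup>2 * g t)"

definition Psi ::
  "ennreal \<Rightarrow> nat \<Rightarrow> (nat \<Rightarrow> real ^ 'd \<Rightarrow> real) \<Rightarrow> (real ^ 'd \<Rightarrow> real) set" where
  "Psi p N F = {probe p (\<lambda>t. F i t - F j t) | i j. i \<in> {1..N} \<and> j \<in> {1..N} \<and> i \<noteq> j}"

definition kappa ::
  "'w measure \<Rightarrow> ((real ^ 'd \<Rightarrow> real) \<Rightarrow> 'w \<Rightarrow> real) \<Rightarrow> real \<Rightarrow> (real ^ 'd \<Rightarrow> real) set \<Rightarrow> real" where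
  "kappa M Z \<epsilon> \<Psi> = (LEAST k. k > 0 \<and>
     measure M {\<omega> \<in> space M. (MAX \<psi>\<in>\<Psi>. \<bar>Z \<psi> \<omega>\<bar> / cube_norm 2 \<psi>) \<ge> k} \<le> \<epsilon>)"

definition Mhat ::
  "((real ^ 'd \<Rightarrow> real) \<Rightarrow> 'w \<Rightarrow> real) \<Rightarrow> real \<Rightarrow> ennreal \<Rightarrow> real \<Rightarrow>
   (real ^ 'd \<Rightarrow> real) set \<Rightarrow> (real ^ 'd \<Rightarrow> real) \<Rightarrow> 'w \<Rightarrow> real" where
  "Mhat Y \<epsilon> q k \<Psi> h \<omega> =
     (MAX \<psi>\<in>\<Psi>. 1 / cube_norm q \<psi> * (\<bar>Delta Y h \<psi> \<omega>\<bar> - \<epsilon> * k * cube_norm 2 \<psi>))"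

definition risk ::
  "'w measure \<Rightarrow> ennreal \<Rightarrow> ('w \<Rightarrow> real ^ 'd \<Rightarrow> real) \<Rightarrow> (real ^ 'd \<Rightarrow> real) \<Rightarrow> real" where
  "risk M p fhat f = (LINT \<omega>|M. cube_norm p (\<lambda>t. fhat \<omega> t - f t))"

definition Q2 ::
  "ennreal \<Rightarrow> ennreal \<Rightarrow> nat \<Rightarrow> (nat \<Rightarrow> real ^ 'd \<Rightarrow> real) \<Rightarrow> nat \<Rightarrow> real" where
  "Q2 p q N F j = (MAX i\<in>{1..N} - {j}.
     cube_norm p (\<lambda>t. F j t - F i t) * cube_norm q (\<lambda>t. F j t - F i t)
       / (cube_norm 2 (\<lambda>t. F j t - F i t))\<^sup>2)"

definition Q3 ::
  "ennreal \<Rightarrow> nat \<Rightarrow> (nat \<Rightarrow> real ^ 'd \<Rightarrow> real) \<Rightarrow> nat \<Rightarrow> real" where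
  "Q3 p N F j = (MAX i\<in>{1..N} - {j}.
     cube_norm p (\<lambda>t. F j t - F i t) / cube_norm 2 (\<lambda>t. F j t - F i t))"

end

theory Submission
  imports Defs
begin

text \<open>
Why the bound holds. Let $a = i_*$ and $b = \hat\imath$. The probe function $\psi$ of $g = F_a - F_b$
is the multiple of $g$ with $\<integral> \psi g = \|g\|_p$. Hence $\|F_a - F_b\|_p$ is the difference of the
statistics $\<Delta>_b(\psi)$ and $\<Delta>_a(\psi)$, both of which are observable, and it is enough to show
that these two are small.

Suppose that the noise satisfies $|Z(\psi)| \<le> \<kappa> \|\psi\|_2$ for all probes. Then the criterion
of $a$ only sees the bias $\<integral> \psi (f - F_a)$ divided by $\|\psi\|_q$, which is at most
$\|f - F_a\|_p$ by Hoelder's inequality (\<open>Mhat_le\<close>). The criterion of $b$ is no larger, because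
$b$ minimises it. Unfolding the criteria at $\psi$ bounds both statistics by
$\|\psi\|_q \|f - F_a\|_p + \<epsilon> \<kappa> \|\psi\|_2$, and for the probe of $F_a - F_b$ the two norms are
at most $Q_2$ and $Q_3$. With the triangle inequality for $F_b - f = (F_a - f) - g$ this is
\<open>selection_oracle_inequality\<close>.

There remain two facts about $\<kappa>$ (\<open>Max_std_normal_quantile\<close>). First, the least level is
attained, so that the noise condition fails with probability at most $\<epsilon>$: each $Z(\psi)/\|\psi\|_2$ is
standard normal, so the maximum of their absolute values has no atoms and its tail is continuous.
Secondly, $\<kappa> \<le> \sqrt{2 \ln (N^2/\<epsilon>)}$: there are at most $N^2$ probes, and a standard normal
variable exceeds $k$ in absolute value with probability at most $\exp(-k^2/2)$. On the exceptional
event the error is at most $\|F_b\|_p + \|f\|_p \<le> 2 L$, which contributes $2 L \<epsilon>$ to the risk.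

Minkowski's and Hoelder's inequalities are proved for all exponents $1 \<le> p \<le> \<infinity>$, the case
$p = \<infinity>$ being that of the essential supremum.
\<close>

section \<open>The spaces $L_p$, $1 \<le> p \<le> \<infinity>$\<close>

lemma Lp_norm_nonneg: "0 \<le> Lp_norm M p g"
proof (cases "p = top")
  case True
  have False if neg: "esssup M (\<lambda>x. ereal \<bar>g x\<bar>) = ereal s" "s < 0" for s
  proof -
    have meas: "(\<lambda>x. ereal \<bar>g x\<bar>) \<in> borel_measurable M"
      using neg esssup_non_measurable[of "\<lambda>x. ereal \<bar>g x\<bar>" M] by (auto simp: top_ereal_def)
    have "AE x in M. ereal \<bar>g x\<bar> \<le> ereal s"
      using esssup_AE[of "\<lambda>x. ereal \<bar>g x\<bar>" M] neg by simp
    then have "AE x in M. False"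
      by eventually_elim (use neg in auto)
    then have "emeasure M (space M) = 0"
      by (metis ae_filter_eq_bot_iff trivial_limit_def)
    from esssup_zero_space[OF this meas] neg show False by simp
  qed
  then have "0 \<le> real_of_ereal (esssup M (\<lambda>x. ereal \<bar>g x\<bar>))"
    by (cases "esssup M (\<lambda>x. ereal \<bar>g x\<bar>)") force+
  then show ?thesis by (simp add: Lp_norm_def True)
qed (simp add: Lp_norm_def)

lemma in_Lp_top_AE_bound:
  assumes "in_Lp M top g"
  shows "AE x in M. \<bar>g x\<bar> \<le> Lp_norm M top g"
proof -
  have fin: "esssup M (\<lambda>x. ereal \<bar>g x\<bar>) < \<infinity>"
    using assms by (simp add: in_Lp_def)
  show ?thesis
    using esssup_AE[of "\<lambda>x. ereal \<bar>g x\<bar>" M]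
  proof eventually_elim
    case (elim x)
    with fin show ?case
      unfolding Lp_norm_def by (cases "esssup M (\<lambda>x. ereal \<bar>g x\<bar>)") auto
  qed
qed

lemma Lp_norm_top_leI:
  assumes [measurable]: "g \<in> borel_measurable M" and "AE x in M. \<bar>g x\<bar> \<le> c" and "0 \<le> c"
  shows "in_Lp M top g" "Lp_norm M top g \<le> c"
proof -
  have le: "esssup M (\<lambda>x. ereal \<bar>g x\<bar>) \<le> ereal c"
    by (rule esssup_I) (use assms in auto)
  then show "in_Lp M top g" by (auto simp: in_Lp_def)
  from le show "Lp_norm M top g \<le> c"
    using \<open>0 \<le> c\<close> unfolding Lp_norm_def
    by (cases "esssup M (\<lambda>x. ereal \<bar>g x\<bar>)") auto
qed

lemma enn2real_ge_1: "1 \<le> p \<Longrightarrow> p \<noteq> top \<Longrightarrow> 1 \<le> enn2real p"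
  by (metis enn2real_1 enn2real_mono less_top)

lemma Lp_norm_finite_leI:
  assumes "1 \<le> p" "p \<noteq> top" "0 \<le> c"
    and le: "(LINT x|M. \<bar>g x\<bar> powr enn2real p) \<le> c powr enn2real p"
  shows "Lp_norm M p g \<le> c"
proof -
  have r: "1 \<le> enn2real p" using enn2real_ge_1 assms by blast
  have "(LINT x|M. \<bar>g x\<bar> powr enn2real p) powr (1 / enn2real p)
      \<le> (c powr enn2real p) powr (1 / enn2real p)"
    using le r by (intro powr_mono2) auto
  also have "\<dots> = c" using r \<open>0 \<le> c\<close> by (simp add: powr_powr)
  finally show ?thesis using assms by (simp add: Lp_norm_def)
qed

lemma Lp_norm_powr:
  assumes "1 \<le> p" "p \<noteq> top"
  shows "Lp_norm M p g powr enn2real p = (LINT x|M. \<bar>g x\<bar> powr enn2real p)"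
  using enn2real_ge_1[OF assms] assms by (simp add: Lp_norm_def powr_powr)

text \<open>Scaling by a constant strictly above the norm puts a function into the unit ball, where the norm is
controlled by the integral of the $p$-th power. The strict inequality makes the constant positive,
so that Minkowski's and Hoelder's inequalities below need no separate treatment of functions that
vanish almost everywhere: they are proved for all constants above the two norms, and the constants
are then sent to the norms.\<close>

lemma Lp_modular_le_1:
  assumes "1 \<le> p" "p \<noteq> top" "Lp_norm M p g < c"
  shows "(LINT x|M. (\<bar>g x\<bar> / c) powr enn2real p) \<le> 1"
proof -
  have c: "0 < c" using Lp_norm_nonneg[of M p g] assms by linarith
  have "(LINT x|M. (\<bar>g x\<bar> / c) powr enn2real p) = Lp_norm M p g powr enn2real p / c powr enn2real p"
    using c by (simp add: powr_divide Lp_norm_powr[OF assms(1,2)])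
  also have "\<dots> \<le> 1"
    using assms c Lp_norm_nonneg[of M p g] by (auto simp: divide_le_eq intro!: powr_mono2)
  finally show ?thesis .
qed

lemma integrable_Lp_modular:
  assumes "in_Lp M p g" "p \<noteq> top" "0 \<le> c"
  shows "integrable M (\<lambda>x. (\<bar>g x\<bar> / c) powr enn2real p)"
  using assms by (simp add: in_Lp_def powr_divide)

text \<open>The inequality $\|c g\|_p \<le> |c| \|g\|_p$, applied once more with $1/c$ to the function $c g$,
also yields the reverse one.\<close>

lemma Lp_scale:
  assumes p: "1 \<le> p" and g: "in_Lp M p g"
  shows "in_Lp M p (\<lambda>x. c * g x)" "Lp_norm M p (\<lambda>x. c * g x) = \<bar>c\<bar> * Lp_norm M p g"
proof -
  have *: "in_Lp M p (\<lambda>x. c * g x) \<and> Lp_norm M p (\<lambda>x. c * g x) \<le> \<bar>c\<bar> * Lp_norm M p g"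
    if g: "in_Lp M p g" for c g
  proof (cases "p = top")
    case True
    have "AE x in M. \<bar>c * g x\<bar> \<le> \<bar>c\<bar> * Lp_norm M top g"
      using in_Lp_top_AE_bound[OF g[unfolded True]]
      by eventually_elim (auto simp: abs_mult intro: mult_left_mono)
    moreover have "(\<lambda>x. c * g x) \<in> borel_measurable M"
      using g by (auto simp: in_Lp_def intro!: borel_measurable_times)
    ultimately show ?thesis
      using Lp_norm_top_leI[of "\<lambda>x. c * g x" M "\<bar>c\<bar> * Lp_norm M top g"] Lp_norm_nonneg[of M top g]
      by (simp add: True)
  next
    case False
    have eq: "(LINT x|M. \<bar>c * g x\<bar> powr enn2real p) = (\<bar>c\<bar> * Lp_norm M p g) powr enn2real p"
      by (simp add: abs_mult powr_mult Lp_norm_nonneg Lp_norm_powr[OF p False])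
    have "Lp_norm M p (\<lambda>x. c * g x) \<le> \<bar>c\<bar> * Lp_norm M p g"
      by (rule Lp_norm_finite_leI) (use p False eq Lp_norm_nonneg[of M p g] in auto)
    then show ?thesis
      using g False by (auto simp: in_Lp_def abs_mult powr_mult)
  qed
  show "in_Lp M p (\<lambda>x. c * g x)" using *[OF g] by blast
  show "Lp_norm M p (\<lambda>x. c * g x) = \<bar>c\<bar> * Lp_norm M p g"
  proof (cases "c = 0")
    case True
    with *[OF g, of c] Lp_norm_nonneg[of M p "\<lambda>x. c * g x"] show ?thesis by simp
  next
    case False
    have "Lp_norm M p g = Lp_norm M p (\<lambda>x. inverse c * (c * g x))"
      using False by (simp add: field_simps)
    also have "\<dots> \<le> \<bar>inverse c\<bar> * Lp_norm M p (\<lambda>x. c * g x)"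
      using * *[OF g, of c] by blast
    finally have "\<bar>c\<bar> * Lp_norm M p g \<le> Lp_norm M p (\<lambda>x. c * g x)"
      using False by (simp add: field_simps)
    with *[OF g, of c] show ?thesis by force
  qed
qed

text \<open>Convexity of $x \<mapsto> x^r$ on the closed half-line: in the interior it is a second-derivative
statement, and at the end point $0$ it reduces to $w^r \<le> w$ for $w \<le> 1$.\<close>

lemma convex_powr_nonneg:
  fixes r :: real
  assumes r: "1 \<le> r" and "0 \<le> x" "0 \<le> y" "0 < u" "0 < v" "u + v = 1"
  shows "(u * x + v * y) powr r \<le> u * x powr r + v * y powr r"
proof -
  have zero: "(w * z) powr r \<le> w * z powr r" if "0 < w" "w \<le> 1" "0 \<le> z" for w z :: real
  proof -
    have "w powr r \<le> w powr 1" using that r by (intro powr_mono') auto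
    then show ?thesis using that by (simp add: powr_mult mult_right_mono)
  qed
  consider "x = 0" | "y = 0" | "0 < x" "0 < y" using assms by linarith
  then show ?thesis
  proof cases
    case 3
    then show ?thesis
      using powr_convex[OF r] assms by (simp add: convex_on_def)
  qed (use zero assms in auto)
qed

text \<open>The pointwise form of Minkowski's inequality: $|s| + |t|$ is $(a + b)$ times the convex combination
of $|s|/a$ and $|t|/b$ with weights $a/(a+b)$ and $b/(a+b)$. When $a$ and $b$ are upper bounds for
the two norms, the integral of the bracket is at most $1$.\<close>

lemma abs_add_powr_le:
  fixes r :: real
  assumes r: "1 \<le> r" and a: "0 < a" and b: "0 < b"
  shows "\<bar>s + t\<bar> powr r
    \<le> (a + b) powr r * (a / (a + b) * (\<bar>s\<bar> / a) powr r + b / (a + b) * (\<bar>t\<bar> / b) powr r)"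
proof -
  have "\<bar>s + t\<bar> powr r \<le> (\<bar>s\<bar> + \<bar>t\<bar>) powr r"
    using r by (intro powr_mono2) auto
  also have "\<bar>s\<bar> + \<bar>t\<bar> = (a + b) * (a / (a + b) * (\<bar>s\<bar> / a) + b / (a + b) * (\<bar>t\<bar> / b))"
    using a b by (simp add: add_divide_distrib[symmetric])
  also have "\<dots> powr r = (a + b) powr r * (a / (a + b) * (\<bar>s\<bar> / a) + b / (a + b) * (\<bar>t\<bar> / b)) powr r"
    using a b by (intro powr_mult)
  also have "\<dots> \<le> (a + b) powr r * (a / (a + b) * (\<bar>s\<bar> / a) powr r + b / (a + b) * (\<bar>t\<bar> / b) powr r)"
    using a b r by (intro mult_left_mono convex_powr_nonneg) (auto simp: add_divide_distrib[symmetric])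
  finally show ?thesis .
qed

lemma Minkowski:
  assumes p: "1 \<le> p" and g: "in_Lp M p g" and h: "in_Lp M p h"
  shows "in_Lp M p (\<lambda>x. g x + h x)"
    and "Lp_norm M p (\<lambda>x. g x + h x) \<le> Lp_norm M p g + Lp_norm M p h"
proof -
  have [measurable]: "g \<in> borel_measurable M" "h \<in> borel_measurable M"
    using g h by (auto simp: in_Lp_def)
  have "in_Lp M p (\<lambda>x. g x + h x) \<and>
    Lp_norm M p (\<lambda>x. g x + h x) \<le> Lp_norm M p g + Lp_norm M p h"
  proof (cases "p = top")
    case True
    have "AE x in M. \<bar>g x + h x\<bar> \<le> Lp_norm M top g + Lp_norm M top h"
      using in_Lp_top_AE_bound[OF g[unfolded True]] in_Lp_top_AE_bound[OF h[unfolded True]]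
      by eventually_elim auto
    then show ?thesis
      using Lp_norm_top_leI[of "\<lambda>x. g x + h x" M "Lp_norm M top g + Lp_norm M top h"]
        Lp_norm_nonneg[of M top] by (simp add: True)
  next
    case False
    define r where "r = enn2real p"
    have r: "1 \<le> r" using enn2real_ge_1[OF p False] by (simp add: r_def)
    have step: "integrable M (\<lambda>x. \<bar>g x + h x\<bar> powr r) \<and> Lp_norm M p (\<lambda>x. g x + h x) \<le> a + b"
      if a: "Lp_norm M p g < a" and b: "Lp_norm M p h < b" for a b
    proof -
      have pos: "0 < a" "0 < b"
        using a b Lp_norm_nonneg[of M p g] Lp_norm_nonneg[of M p h] by linarith+
      let ?B = "\<lambda>x. (a + b) powr r *
        (a / (a + b) * (\<bar>g x\<bar> / a) powr r + b / (a + b) * (\<bar>h x\<bar> / b) powr r)"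
      have int: "integrable M (\<lambda>x. (\<bar>g x\<bar> / a) powr r)" "integrable M (\<lambda>x. (\<bar>h x\<bar> / b) powr r)"
        using integrable_Lp_modular[OF g False, of a] integrable_Lp_modular[OF h False, of b] pos
        by (auto simp: r_def)
      have intB: "integrable M ?B" using int by simp
      have le: "\<bar>g x + h x\<bar> powr r \<le> ?B x" for x by (rule abs_add_powr_le[OF r pos])
      have int_sum: "integrable M (\<lambda>x. \<bar>g x + h x\<bar> powr r)"
        by (rule Bochner_Integration.integrable_bound[OF intB]) (use le in \<open>auto intro!: AE_I2 order_trans[OF _ abs_ge_self]\<close>)
      have "(LINT x|M. \<bar>g x + h x\<bar> powr r) \<le> (LINT x|M. ?B x)"
        by (rule integral_mono[OF int_sum intB le])
      also have "\<dots> = (a + b) powr r * (a / (a + b) * (LINT x|M. (\<bar>g x\<bar> / a) powr r)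
          + b / (a + b) * (LINT x|M. (\<bar>h x\<bar> / b) powr r))"
        using int by simp
      also have "\<dots> \<le> (a + b) powr r * (a / (a + b) * 1 + b / (a + b) * 1)"
        using Lp_modular_le_1[OF p False a] Lp_modular_le_1[OF p False b] pos
        by (intro mult_left_mono add_mono) (auto simp: r_def)
      also have "\<dots> = (a + b) powr r"
        using pos by (simp add: add_divide_distrib[symmetric])
      finally show ?thesis
        using int_sum pos by (auto simp: r_def intro!: Lp_norm_finite_leI[OF p False])
    qed
    have "Lp_norm M p (\<lambda>x. g x + h x) \<le> Lp_norm M p g + Lp_norm M p h"
    proof (rule field_le_epsilon)
      fix e :: real assume "0 < e"
      then show "Lp_norm M p (\<lambda>x. g x + h x) \<le> Lp_norm M p g + Lp_norm M p h + e"
        using step[of "Lp_norm M p g + e / 2" "Lp_norm M p h + e / 2"] by simp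
    qed
    moreover have "in_Lp M p (\<lambda>x. g x + h x)"
      using step[of "Lp_norm M p g + 1" "Lp_norm M p h + 1"] False by (simp add: in_Lp_def r_def)
    ultimately show ?thesis by blast
  qed
  then show "in_Lp M p (\<lambda>x. g x + h x)"
    "Lp_norm M p (\<lambda>x. g x + h x) \<le> Lp_norm M p g + Lp_norm M p h" by auto
qed

lemma Lp_diff:
  assumes p: "1 \<le> p" and g: "in_Lp M p g" and h: "in_Lp M p h"
  shows "in_Lp M p (\<lambda>x. g x - h x)"
    and "Lp_norm M p (\<lambda>x. g x - h x) \<le> Lp_norm M p g + Lp_norm M p h"
  using Minkowski[OF p g Lp_scale(1)[OF p h, of "-1"]] Lp_scale(2)[OF p h, of "-1"] by auto

lemma Hoelder_1_top:
  assumes g: "in_Lp M 1 g" and h: "in_Lp M top h"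
  shows "integrable M (\<lambda>x. g x * h x)"
    and "\<bar>LINT x|M. g x * h x\<bar> \<le> Lp_norm M 1 g * Lp_norm M top h"
proof -
  have [measurable]: "g \<in> borel_measurable M" "h \<in> borel_measurable M"
    using g h by (auto simp: in_Lp_def)
  have norm: "Lp_norm M 1 g = (LINT x|M. \<bar>g x\<bar>)"
    by (simp add: Lp_norm_def)
  have int: "integrable M (\<lambda>x. \<bar>g x\<bar>)" using g by (simp add: in_Lp_def)
  have le: "AE x in M. \<bar>g x * h x\<bar> \<le> \<bar>g x\<bar> * Lp_norm M top h"
    using in_Lp_top_AE_bound[OF h] by eventually_elim (auto simp: abs_mult intro: mult_left_mono)
  show int': "integrable M (\<lambda>x. g x * h x)"
    by (rule Bochner_Integration.integrable_bound[of _ "\<lambda>x. \<bar>g x\<bar> * Lp_norm M top h"])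
      (use int le in \<open>auto simp: Lp_norm_nonneg\<close>)
  have "\<bar>LINT x|M. g x * h x\<bar> \<le> (LINT x|M. \<bar>g x * h x\<bar>)" by (rule integral_abs_bound)
  also have "\<dots> \<le> (LINT x|M. \<bar>g x\<bar> * Lp_norm M top h)"
    using int int' le by (intro integral_mono_AE) auto
  finally show "\<bar>LINT x|M. g x * h x\<bar> \<le> Lp_norm M 1 g * Lp_norm M top h"
    using int by (simp add: norm)
qed

lemma ennreal_inverse_eq_1D:
  assumes "inverse (q::ennreal) = 1"
  shows "q = 1"
proof (cases q)
  case (real r)
  then have "0 < r" using assms by (cases "r = 0") auto
  with assms real have "ennreal (inverse r) = ennreal 1"
    by (simp add: inverse_ennreal)
  with \<open>0 < r\<close> have "inverse r = 1" by (subst (asm) ennreal_inj) auto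
  then show ?thesis using real by simp
qed (use assms in auto)

lemma conjugate_cases [consumes 2, case_names one_top top_one finite]:
  fixes p q :: ennreal
  assumes p: "1 \<le> p" and pq: "inverse p + inverse q = 1"
  obtains "p = 1" "q = top" | "p = top" "q = 1"
    | "p \<noteq> top" "q \<noteq> top" "1 \<le> q" "1 / enn2real p + 1 / enn2real q = 1"
proof -
  consider "p = top" | "q = top" | "p \<noteq> top" "q \<noteq> top" by blast
  then show thesis
  proof cases
    case 1
    then have "inverse q = 1" using pq by simp
    then have "q = 1" by (rule ennreal_inverse_eq_1D)
    then show thesis using 1 that by blast
  next
    case 2
    then have "inverse p = 1" using pq by simp
    then have "p = 1" by (rule ennreal_inverse_eq_1D)
    then show thesis using 2 that by blast
  next
    case 3
    then obtain r where r: "p = ennreal r" "1 \<le> r" 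
      using enn2real_ge_1[OF p] by (metis ennreal_enn2real less_top)
    have q0: "q \<noteq> 0" using pq by auto
    then obtain s where s: "q = ennreal s" "0 < s"
      using 3 by (metis enn2real_nonneg ennreal_enn2real less_top ennreal_0 order_le_less)
    have "ennreal (1 / r + 1 / s) = ennreal 1"
      using pq r s by (simp add: inverse_ennreal divide_inverse ennreal_plus)
    then have rs: "1 / r + 1 / s = 1"
      using r s by (subst (asm) ennreal_inj) auto
    have "0 \<le> 1 / r" using r by simp
    with rs have "1 / s \<le> 1" by linarith
    then have "1 \<le> s" using s by (simp add: field_simps)
    then show thesis using that(3) 3 r s rs by simp
  qed
qed

text \<open>For finite exponents, Young's inequality for the functions scaled into their unit balls.\<close>

theorem Hoelder:
  assumes p: "1 \<le> p" and pq: "inverse p + inverse q = 1"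
    and g: "in_Lp M p g" and h: "in_Lp M q h"
  shows "integrable M (\<lambda>x. g x * h x)"
    and "\<bar>LINT x|M. g x * h x\<bar> \<le> Lp_norm M p g * Lp_norm M q h"
proof -
  have [measurable]: "g \<in> borel_measurable M" "h \<in> borel_measurable M"
    using g h by (auto simp: in_Lp_def)
  have "integrable M (\<lambda>x. g x * h x) \<and> \<bar>LINT x|M. g x * h x\<bar> \<le> Lp_norm M p g * Lp_norm M q h"
    using p pq
  proof (cases rule: conjugate_cases)
    case one_top
    then show ?thesis using Hoelder_1_top g h by blast
  next
    case top_one
    then show ?thesis using Hoelder_1_top[of M h g] g h by (simp add: mult.commute)
  next
    case finite
    define r s where "r = enn2real p" and "s = enn2real q"
    have rs: "1 / r + 1 / s = 1" "1 \<le> r" "1 \<le> s"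
      using finite enn2real_ge_1 p by (auto simp: r_def s_def)
    have rs': "1 < r" "1 < s"
    proof -
      have "r \<noteq> 1" "s \<noteq> 1" using rs by auto
      then show "1 < r" "1 < s" using rs by linarith+
    qed
    have step: "integrable M (\<lambda>x. g x * h x) \<and> \<bar>LINT x|M. g x * h x\<bar> \<le> a * b"
      if a: "Lp_norm M p g < a" and b: "Lp_norm M q h < b" for a b
    proof -
      have pos: "0 < a" "0 < b"
        using a b Lp_norm_nonneg[of M p g] Lp_norm_nonneg[of M q h] by linarith+
      let ?B = "\<lambda>x. a * b * ((\<bar>g x\<bar> / a) powr r / r + (\<bar>h x\<bar> / b) powr s / s)"
      have int: "integrable M (\<lambda>x. (\<bar>g x\<bar> / a) powr r)" "integrable M (\<lambda>x. (\<bar>h x\<bar> / b) powr s)"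
        using integrable_Lp_modular[OF g, of a] integrable_Lp_modular[OF h, of b] finite pos
        by (auto simp: r_def s_def)
      have intB: "integrable M ?B" using int by simp
      have le: "\<bar>g x * h x\<bar> \<le> ?B x" for x
      proof -
        have "\<bar>g x\<bar> / a * (\<bar>h x\<bar> / b) \<le> (\<bar>g x\<bar> / a) powr r / r + (\<bar>h x\<bar> / b) powr s / s"
          using Youngs_inequality[of r s "\<bar>g x\<bar> / a" "\<bar>h x\<bar> / b"] rs rs' pos by simp
        then have "a * b * (\<bar>g x\<bar> / a * (\<bar>h x\<bar> / b)) \<le> ?B x"
          using pos by (intro mult_left_mono) auto
        then show ?thesis using pos by (simp add: abs_mult)
      qed
      have int': "integrable M (\<lambda>x. g x * h x)"
        by (rule Bochner_Integration.integrable_bound[OF intB]) (use le in \<open>auto intro!: AE_I2 order_trans[OF _ abs_ge_self]\<close>)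
      have "\<bar>LINT x|M. g x * h x\<bar> \<le> (LINT x|M. \<bar>g x * h x\<bar>)" by (rule integral_abs_bound)
      also have "\<dots> \<le> (LINT x|M. ?B x)"
        by (rule integral_mono[OF _ intB le]) (use int' in simp)
      also have "\<dots> = a * b * ((LINT x|M. (\<bar>g x\<bar> / a) powr r) / r + (LINT x|M. (\<bar>h x\<bar> / b) powr s) / s)"
        using int by simp
      also have "\<dots> \<le> a * b * (1 / r + 1 / s)"
        using Lp_modular_le_1[OF p _ a] Lp_modular_le_1[OF _ _ b] finite pos rs
        by (intro mult_left_mono add_mono divide_right_mono) (auto simp: r_def s_def)
      finally show ?thesis using int' rs by simp
    qed
    have "((\<lambda>e. (Lp_norm M p g + e) * (Lp_norm M q h + e)) \<longlongrightarrow> 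
        (Lp_norm M p g + 0) * (Lp_norm M q h + 0)) (at_right 0)"
      by (intro tendsto_intros)
    moreover have "eventually (\<lambda>e. \<bar>LINT x|M. g x * h x\<bar> \<le> (Lp_norm M p g + e) * (Lp_norm M q h + e))
        (at_right (0::real))"
      by (rule eventually_at_right_less[THEN eventually_mono]) (use step in auto)
    ultimately have "\<bar>LINT x|M. g x * h x\<bar> \<le> (Lp_norm M p g + 0) * (Lp_norm M q h + 0)"
      by (rule tendsto_lowerbound) simp
    then show ?thesis
      using step[of "Lp_norm M p g + 1" "Lp_norm M q h + 1"] by simp
  qed
  then show "integrable M (\<lambda>x. g x * h x)"
    "\<bar>LINT x|M. g x * h x\<bar> \<le> Lp_norm M p g * Lp_norm M q h" by auto
qed

lemma Lp_norm_pos: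
  assumes p: "1 \<le> p" and g: "in_Lp M p g" and nz: "\<not> (AE x in M. g x = 0)"
  shows "0 < Lp_norm M p g"
proof (rule ccontr)
  assume "\<not> 0 < Lp_norm M p g"
  then have zero: "Lp_norm M p g = 0" using Lp_norm_nonneg[of M p g] by linarith
  have "AE x in M. g x = 0"
  proof (cases "p = top")
    case True
    then show ?thesis using in_Lp_top_AE_bound[of M g] g zero by simp
  next
    case False
    then have "(LINT x|M. \<bar>g x\<bar> powr enn2real p) = 0"
      using Lp_norm_powr[OF p False, of M g] zero enn2real_ge_1[OF p False] by simp
    moreover have "integrable M (\<lambda>x. \<bar>g x\<bar> powr enn2real p)"
      using g False by (simp add: in_Lp_def)
    ultimately have "AE x in M. \<bar>g x\<bar> powr enn2real p = 0"
      by (subst (asm) integral_nonneg_eq_0_iff_AE) auto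
    then show ?thesis by simp
  qed
  with nz show False by blast
qed

lemma L2_norm_square:
  "(Lp_norm M 2 g)\<^sup>2 = (LINT x|M. g x * g x)"
  using Lp_norm_powr[of 2 M g] Lp_norm_nonneg[of M 2 g] by (simp add: powr_numeral power2_eq_square)

section \<open>The quantile of the maximum of standard normal variables\<close>

text \<open>With $y = x - k \<ge> 0$ one has $x^2 = k^2 + 2 k y + y^2 \<ge> k^2 + y^2$.\<close>

lemma std_normal_density_shift_le:
  assumes "0 \<le> k" "k \<le> x"
  shows "std_normal_density x \<le> exp (- k\<^sup>2 / 2) * std_normal_density (x - k)"
proof -
  have "0 \<le> k * (x - k)" using assms by simp
  then have "- x\<^sup>2 / 2 \<le> - k\<^sup>2 / 2 + - (x - k)\<^sup>2 / 2"
    by (simp add: power2_eq_square field_simps)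
  then have "exp (- x\<^sup>2 / 2) \<le> exp (- k\<^sup>2 / 2) * exp (- (x - k)\<^sup>2 / 2)"
    unfolding exp_add[symmetric] by simp
  then show ?thesis
    by (simp add: std_normal_density_def divide_right_mono)
qed

lemma std_normal_density_uminus: "std_normal_density (- x) = std_normal_density x"
  by (simp add: std_normal_density_def)

text \<open>Shifting the two tails towards the origin by $k$ costs the factor $\exp(-k^2/2)$ each, and the
shifted tails are the two half-lines, which together carry mass $1$. The usual exponential moment
bound would lose a factor $2$ here; with the sharp constant, a union bound over all ordered pairs
$(i, j)$ stays below $N^2 \exp(-k^2/2)$.\<close>

lemma (in prob_space) std_normal_tail_bound:
  assumes X: "distributed M lborel X std_normal_density" and k: "0 \<le> k"
  shows "prob {\<omega> \<in> space M. k \<le> \<bar>X \<omega>\<bar>} \<le> exp (- k\<^sup>2 / 2)"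
proof -
  let ?d = "\<lambda>x. ennreal (std_normal_density x)"
  let ?e = "ennreal (exp (- k\<^sup>2 / 2))"
  have pw: "?d x * indicator {x. k \<le> \<bar>x\<bar>} x
      \<le> ?e * (?d (x - k) * indicator {k..} x) + ?e * (?d (x + k) * indicator {..- k} x)" for x
  proof (cases "k \<le> x")
    case True
    have "?d x \<le> ?e * ?d (x - k)"
      using std_normal_density_shift_le[OF k True] by (simp add: ennreal_mult'[symmetric])
    then show ?thesis using True by (auto simp: indicator_def intro: order_trans)
  next
    case False
    have "?d x \<le> ?e * ?d (x + k)" if "k \<le> - x"
      using std_normal_density_shift_le[OF k that] std_normal_density_uminus[of x]
        std_normal_density_uminus[of "x + k"]
      by (simp add: ennreal_mult'[symmetric])
    then show ?thesis using False by (auto simp: indicator_def abs_if)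
  qed
  have "emeasure M (X -` {x. k \<le> \<bar>x\<bar>} \<inter> space M) = (\<integral>\<^sup>+ x. ?d x * indicator {x. k \<le> \<bar>x\<bar>} x \<partial>lborel)"
    by (rule distributed_emeasure[OF X]) simp
  also have "\<dots> \<le> (\<integral>\<^sup>+ x. ?e * (?d (x - k) * indicator {k..} x) + ?e * (?d (x + k) * indicator {..- k} x) \<partial>lborel)"
    by (rule nn_integral_mono) (rule pw)
  also have "\<dots> = ?e * ((\<integral>\<^sup>+ x. ?d (x - k) * indicator {k..} x \<partial>lborel)
      + (\<integral>\<^sup>+ x. ?d (x + k) * indicator {..- k} x \<partial>lborel))"
    by (simp add: nn_integral_add nn_integral_cmult distrib_left)
  also have "(\<integral>\<^sup>+ x. ?d (x - k) * indicator {k..} x \<partial>lborel) = (\<integral>\<^sup>+ y. ?d y * indicator {0..} y \<partial>lborel)"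
    by (subst nn_integral_real_affine[where c = 1 and t = k])
      (auto intro!: nn_integral_cong simp: indicator_def)
  also have "(\<integral>\<^sup>+ x. ?d (x + k) * indicator {..- k} x \<partial>lborel) = (\<integral>\<^sup>+ y. ?d y * indicator {..0} y \<partial>lborel)"
    by (subst nn_integral_real_affine[where c = 1 and t = "- k"])
      (auto intro!: nn_integral_cong simp: indicator_def)
  also have "(\<integral>\<^sup>+ y. ?d y * indicator {0..} y \<partial>lborel) + (\<integral>\<^sup>+ y. ?d y * indicator {..0} y \<partial>lborel)
      = (\<integral>\<^sup>+ y. ?d y * indicator {0..} y + ?d y * indicator {..0} y \<partial>lborel)"
    by (simp add: nn_integral_add)
  also have "\<dots> = (\<integral>\<^sup>+ y. ?d y \<partial>lborel)"
    using AE_lborel_singleton[of "0::real"]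
    by (intro nn_integral_cong_AE, eventually_elim) (auto simp: indicator_def)
  also have "\<dots> = 1"
    using distributed_emeasure[OF X, of UNIV] by (simp add: emeasure_space_1)
  finally have "emeasure M (X -` {x. k \<le> \<bar>x\<bar>} \<inter> space M) \<le> ?e" by simp
  moreover have "X -` {x. k \<le> \<bar>x\<bar>} \<inter> space M = {\<omega> \<in> space M. k \<le> \<bar>X \<omega>\<bar>}" by auto
  ultimately show ?thesis by (simp add: emeasure_eq_measure)
qed

text \<open>Without atoms, the upper tail is one minus the distribution function, and the latter is
continuous.\<close>

lemma (in prob_space) continuous_upper_tail:
  fixes Y :: "'a \<Rightarrow> real"
  assumes Y[measurable]: "Y \<in> borel_measurable M"
    and atomless: "\<And>y. prob {\<omega> \<in> space M. Y \<omega> = y} = 0"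
  shows "continuous_on UNIV (\<lambda>k. prob {\<omega> \<in> space M. k \<le> Y \<omega>})"
proof -
  interpret D: real_distribution "distr M borel Y" by (rule real_distribution_distr[OF Y])
  have "prob {\<omega> \<in> space M. k \<le> Y \<omega>} = 1 - cdf (distr M borel Y) k" for k
  proof -
    have "cdf (distr M borel Y) k = prob {\<omega> \<in> space M. Y \<omega> \<le> k}"
      by (simp add: cdf_def measure_distr vimage_def Int_def conj_commute)
    also have "\<dots> = prob ({\<omega> \<in> space M. Y \<omega> < k} \<union> {\<omega> \<in> space M. Y \<omega> = k})"
      by (rule arg_cong[where f = prob]) auto
    also have "\<dots> = prob {\<omega> \<in> space M. Y \<omega> < k} + prob {\<omega> \<in> space M. Y \<omega> = k}"
      by (rule finite_measure_Union) auto
    also have "\<dots> = prob {\<omega> \<in> space M. Y \<omega> < k}" by (simp add: atomless)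
    also have "\<dots> = prob (space M - {\<omega> \<in> space M. k \<le> Y \<omega>})"
      by (rule arg_cong[where f = prob]) auto
    also have "\<dots> = 1 - prob {\<omega> \<in> space M. k \<le> Y \<omega>}"
      by (rule prob_compl) auto
    finally show ?thesis by simp
  qed
  moreover have "continuous_on UNIV (\<lambda>k. 1 - cdf (distr M borel Y) k)"
  proof (intro continuous_on_diff continuous_on_const continuous_at_imp_continuous_on ballI)
    fix y
    have "measure (distr M borel Y) {y} = 0"
      using atomless[of y] by (simp add: measure_distr vimage_def Int_def conj_commute)
    then show "isCont (cdf (distr M borel Y)) y" by (simp add: D.isCont_cdf)
  qed
  ultimately show ?thesis by simp
qed

text \<open>The infimum of the admissible levels is attained because the upper tail is continuous. It is
positive because the tail equals $1 > \<epsilon>$ at $0$; hence requiring $k \<ge> 0$ in place of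
$k > 0$ gives the same set, which is now visibly closed.\<close>

lemma (in prob_space) Least_upper_quantile:
  fixes Y :: "'a \<Rightarrow> real" and \<epsilon> :: real
  assumes Y: "Y \<in> borel_measurable M" "\<And>\<omega>. \<omega> \<in> space M \<Longrightarrow> 0 \<le> Y \<omega>"
    and atomless: "\<And>y. prob {\<omega> \<in> space M. Y \<omega> = y} = 0"
    and "\<epsilon> < 1" and b: "0 < b" "prob {\<omega> \<in> space M. b \<le> Y \<omega>} \<le> \<epsilon>"
  defines "\<kappa> \<equiv> LEAST k. 0 < k \<and> prob {\<omega> \<in> space M. k \<le> Y \<omega>} \<le> \<epsilon>"
  shows "0 < \<kappa>" "prob {\<omega> \<in> space M. \<kappa> \<le> Y \<omega>} \<le> \<epsilon>" "\<kappa> \<le> b"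
proof -
  let ?G = "\<lambda>k. prob {\<omega> \<in> space M. k \<le> Y \<omega>}"
  define S where "S = {k. 0 \<le> k \<and> ?G k \<le> \<epsilon>}"
  have "?G 0 = prob (space M)"
    using Y(2) by (intro arg_cong[where f = prob]) auto
  then have "?G 0 = 1" by (simp add: prob_space)
  then have pos: "0 < k \<and> ?G k \<le> \<epsilon> \<longleftrightarrow> k \<in> S" for k
    using \<open>\<epsilon> < 1\<close> by (cases "k = 0") (auto simp: S_def)
  have "closed S"
    unfolding S_def using continuous_upper_tail[OF Y(1) atomless]
    by (intro closed_Collect_conj closed_Collect_le continuous_intros) auto
  moreover have "b \<in> S" using b pos by blast
  moreover have bdd: "bdd_below S" by (auto simp: S_def bdd_below_def)
  ultimately have "Inf S \<in> S" by (intro closed_contains_Inf) auto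
  then have "\<kappa> = Inf S"
    unfolding \<kappa>_def pos using bdd by (intro Least_equality cInf_lower)
  with \<open>Inf S \<in> S\<close> \<open>b \<in> S\<close> bdd pos show "0 < \<kappa>" "?G \<kappa> \<le> \<epsilon>" "\<kappa> \<le> b"
    by (auto intro: cInf_lower)
qed

text \<open>Both that the maximum has no atoms and that its upper tail is small at $\sqrt{2 \ln (n/\<epsilon>)}$
follow from the marginal laws by a union bound, whatever the dependence between the variables.\<close>

lemma (in prob_space) Max_std_normal_quantile:
  fixes X :: "'t \<Rightarrow> 'a \<Rightarrow> real"
  assumes T: "finite T" "T \<noteq> {}"
    and X: "\<And>t. t \<in> T \<Longrightarrow> distributed M lborel (X t) std_normal_density"
    and \<epsilon>: "0 < \<epsilon>" "\<epsilon> < 1" and n: "real (card T) \<le> n"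
  defines "\<kappa> \<equiv> LEAST k. 0 < k \<and> prob {\<omega> \<in> space M. k \<le> (MAX t\<in>T. \<bar>X t \<omega>\<bar>)} \<le> \<epsilon>"
  shows "0 < \<kappa>" "prob {\<omega> \<in> space M. \<kappa> \<le> (MAX t\<in>T. \<bar>X t \<omega>\<bar>)} \<le> \<epsilon>"
    and "\<kappa> \<le> sqrt (2 * ln (n / \<epsilon>))"
proof -
  define Y where "Y = (\<lambda>\<omega>. MAX t\<in>T. \<bar>X t \<omega>\<bar>)"
  (* chosen such that exp (- b^2 / 2) = \<epsilon> / n *)
  define b where "b = sqrt (2 * ln (n / \<epsilon>))"
  have meas: "X t \<in> borel_measurable M" if "t \<in> T" for t
    using distributed_measurable[OF X[OF that]] by simp
  have Y_meas: "Y \<in> borel_measurable M"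
    unfolding Y_def using T meas by (intro borel_measurable_Max) auto
  have ge: "k \<le> Y \<omega> \<longleftrightarrow> (\<exists>t\<in>T. k \<le> \<bar>X t \<omega>\<bar>)" for k \<omega>
    unfolding Y_def using T by (auto simp: Max_ge_iff)
  have Y_nonneg: "0 \<le> Y \<omega>" for \<omega>
    using ge[of 0] T by auto
  have X_atomless: "prob (X t -` {y} \<inter> space M) = 0" if "t \<in> T" for t y
  proof -
    have "emeasure M (X t -` {y} \<inter> space M)
        = (\<integral>\<^sup>+ x. ennreal (std_normal_density x) * indicator {y} x \<partial>lborel)"
      by (rule distributed_emeasure[OF X[OF that]]) simp
    also have "\<dots> = 0"
      using AE_lborel_singleton[of y]
      by (subst nn_integral_0_iff_AE) (auto elim!: eventually_mono simp: indicator_def)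
    finally show ?thesis by (simp add: measure_def)
  qed
  have atomless: "prob {\<omega> \<in> space M. Y \<omega> = y} = 0" for y
  proof -
    have sub: "{\<omega> \<in> space M. Y \<omega> = y} \<subseteq> (\<Union>t\<in>T. (X t -` {y} \<inter> space M) \<union> (X t -` {-y} \<inter> space M))"
    proof safe
      fix \<omega> assume "\<omega> \<in> space M" "y = Y \<omega>"
      moreover have "Y \<omega> \<in> (\<lambda>t. \<bar>X t \<omega>\<bar>) ` T" unfolding Y_def using T by (intro Max_in) auto
      ultimately show "\<omega> \<in> (\<Union>t\<in>T. (X t -` {Y \<omega>} \<inter> space M) \<union> (X t -` {- Y \<omega>} \<inter> space M))"
        by (fastforce simp: abs_if split: if_splits)
    qed
    have null: "X t -` {z} \<inter> space M \<in> null_sets M" if "t \<in> T" for t z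
      using X_atomless[OF that, of z] meas[OF that]
      by (auto simp: null_sets_def emeasure_eq_measure measurable_sets)
    have "(\<Union>t\<in>T. (X t -` {y} \<inter> space M) \<union> (X t -` {-y} \<inter> space M)) \<in> null_sets M"
      using T null by (intro null_sets.finite_UN null_sets.Un)
    moreover have "{\<omega> \<in> space M. Y \<omega> = y} \<in> sets M"
      using Y_meas by measurable
    ultimately have "{\<omega> \<in> space M. Y \<omega> = y} \<in> null_sets M"
      using sub by (rule null_sets_subset)
    then show ?thesis by (simp add: measure_def null_setsD1)
  qed
  have "1 \<le> real (card T)" using T by (simp add: Suc_le_eq card_gt_0_iff)
  with n \<epsilon> have "1 \<le> n" "1 < n / \<epsilon>" by (auto simp: less_divide_eq)
  then have b2: "0 < b" "b\<^sup>2 = 2 * ln (n / \<epsilon>)" by (auto simp: b_def)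
  have "prob {\<omega> \<in> space M. b \<le> Y \<omega>} \<le> prob (\<Union>t\<in>T. {\<omega> \<in> space M. b \<le> \<bar>X t \<omega>\<bar>})"
    using T meas by (intro finite_measure_mono sets.finite_UN) (auto simp: ge)
  also have "\<dots> \<le> (\<Sum>t\<in>T. prob {\<omega> \<in> space M. b \<le> \<bar>X t \<omega>\<bar>})"
    using T meas by (intro finite_measure_subadditive_finite) auto
  also have "\<dots> \<le> (\<Sum>t\<in>T. exp (- b\<^sup>2 / 2))"
    using X b2 by (intro sum_mono std_normal_tail_bound) auto
  also have "\<dots> = real (card T) * (\<epsilon> / n)"
    using \<open>1 \<le> n\<close> \<open>1 < n / \<epsilon>\<close> \<epsilon> by (simp add: b2 exp_minus)
  also have "\<dots> \<le> \<epsilon>"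
    using n \<epsilon> \<open>1 \<le> n\<close> by (simp add: divide_le_eq mult.commute)
  finally have "prob {\<omega> \<in> space M. b \<le> Y \<omega>} \<le> \<epsilon>" .
  from Least_upper_quantile[OF Y_meas Y_nonneg atomless \<epsilon>(2) b2(1) this]
  show "0 < \<kappa>" "prob {\<omega> \<in> space M. \<kappa> \<le> (MAX t\<in>T. \<bar>X t \<omega>\<bar>)} \<le> \<epsilon>"
    "\<kappa> \<le> sqrt (2 * ln (n / \<epsilon>))"
    by (auto simp: \<kappa>_def Y_def b_def)
qed

section \<open>White noise, normalised\<close>

context white_noise
begin

lemma Z_gaussian:
  assumes "in_Lp unit_cube 2 \<psi>"
  shows "gaussian_rv M (Z \<psi>)"
  using gaussian[unfolded gaussian_process_def, rule_format, of "{\<psi>}" "\<lambda>_. 1"] assms by simp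

lemma Z_measurable: "in_Lp unit_cube 2 \<psi> \<Longrightarrow> Z \<psi> \<in> borel_measurable M"
  using Z_gaussian by (simp add: gaussian_rv_def)

text \<open>A degenerate law is impossible: it would be the point mass at the mean $0$, whereas the variance
$\|\psi\|_2^2$ is positive. So mean and variance determine the normal law.\<close>

lemma Z_normal:
  assumes \<psi>: "in_Lp unit_cube 2 \<psi>" and pos: "0 < cube_norm 2 \<psi>"
  shows "distributed M lborel (\<lambda>\<omega>. Z \<psi> \<omega> / cube_norm 2 \<psi>) std_normal_density"
proof -
  from Z_gaussian[OF \<psi>] obtain \<mu> where meas: "Z \<psi> \<in> borel_measurable M"
    and \<mu>: "(AE \<omega> in M. Z \<psi> \<omega> = \<mu>) \<or>
       (\<exists>\<sigma>>0. distributed M lborel (Z \<psi>) (\<lambda>x. ennreal (normal_density \<mu> \<sigma> x)))"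
    unfolding gaussian_rv_def by auto
  have var: "expectation (\<lambda>\<omega>. Z \<psi> \<omega> * Z \<psi> \<omega>) = (cube_norm 2 \<psi>)\<^sup>2"
    using covariance[OF \<psi> \<psi>] by (simp add: L2_norm_square)
  from \<mu> show ?thesis
  proof
    assume const: "AE \<omega> in M. Z \<psi> \<omega> = \<mu>"
    have "expectation (Z \<psi>) = expectation (\<lambda>\<omega>. \<mu>)"
      using const meas by (intro integral_cong_AE) auto
    then have "\<mu> = 0" using mean_zero[OF \<psi>] by (simp add: prob_space)
    with const have "AE \<omega> in M. Z \<psi> \<omega> * Z \<psi> \<omega> = 0" by simp
    then have "expectation (\<lambda>\<omega>. Z \<psi> \<omega> * Z \<psi> \<omega>) = 0" by (rule integral_eq_zero_AE)
    with var pos show ?thesis by simp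
  next
    assume "\<exists>\<sigma>>0. distributed M lborel (Z \<psi>) (\<lambda>x. ennreal (normal_density \<mu> \<sigma> x))"
    then obtain \<sigma> where \<sigma>: "0 < \<sigma>" and D: "distributed M lborel (Z \<psi>) (normal_density \<mu> \<sigma>)"
      by auto
    have "\<mu> = 0" using normal_distributed_expectation[OF \<sigma> D] mean_zero[OF \<psi>] by simp
    moreover have "\<sigma>\<^sup>2 = (cube_norm 2 \<psi>)\<^sup>2"
      using normal_distributed_variance[OF \<sigma> D] var mean_zero[OF \<psi>] by (simp add: power2_eq_square)
    then have "\<sigma> = cube_norm 2 \<psi>" using \<sigma> pos by (simp add: power2_eq_iff)
    ultimately show ?thesis
      using D normal_standard_normal_convert[OF \<sigma>, of "Z \<psi>" \<mu>] by simp
  qed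
qed

lemma kappa_quantile:
  assumes \<Psi>: "finite \<Psi>" "\<Psi> \<noteq> {}" and card: "real (card \<Psi>) \<le> n"
    and L2: "\<And>\<psi>. \<psi> \<in> \<Psi> \<Longrightarrow> in_Lp unit_cube 2 \<psi>" "\<And>\<psi>. \<psi> \<in> \<Psi> \<Longrightarrow> 0 < cube_norm 2 \<psi>"
    and \<epsilon>: "0 < \<epsilon>" "\<epsilon> < 1"
  shows "0 < kappa M Z \<epsilon> \<Psi>"
    and "prob {\<omega> \<in> space M. kappa M Z \<epsilon> \<Psi> \<le> (MAX \<psi>\<in>\<Psi>. \<bar>Z \<psi> \<omega>\<bar> / cube_norm 2 \<psi>)} \<le> \<epsilon>"
    and "kappa M Z \<epsilon> \<Psi> \<le> sqrt (2 * ln (n / \<epsilon>))"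
proof -
  have eq: "\<bar>Z \<psi> \<omega>\<bar> / cube_norm 2 \<psi> = \<bar>Z \<psi> \<omega> / cube_norm 2 \<psi>\<bar>" for \<psi> \<omega>
    by (simp add: abs_divide Lp_norm_nonneg)
  note * = Max_std_normal_quantile[OF \<Psi> Z_normal[OF L2] \<epsilon> card]
  from * show "0 < kappa M Z \<epsilon> \<Psi>"
    and "prob {\<omega> \<in> space M. kappa M Z \<epsilon> \<Psi> \<le> (MAX \<psi>\<in>\<Psi>. \<bar>Z \<psi> \<omega>\<bar> / cube_norm 2 \<psi>)} \<le> \<epsilon>"
    and "kappa M Z \<epsilon> \<Psi> \<le> sqrt (2 * ln (n / \<epsilon>))"
    unfolding kappa_def eq by auto
qed

end

section \<open>Probe functions\<close>

lemma Lp_norm_minus_commute: "Lp_norm M p (\<lambda>t. g t - h t) = Lp_norm M p (\<lambda>t. h t - g t)"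
  by (simp add: Lp_norm_def abs_minus_commute)

lemma conjugate_ge_1:
  fixes p q :: ennreal
  assumes "1 \<le> p" "inverse p + inverse q = 1"
  shows "1 \<le> q"
  using assms by (cases rule: conjugate_cases) auto

lemma Lp_probe:
  assumes "1 \<le> r" "in_Lp unit_cube r g"
  shows "in_Lp unit_cube r (probe p g)"
    and "cube_norm r (probe p g) = cube_norm p g * cube_norm r g / (cube_norm 2 g)\<^sup>2"
  using Lp_scale[OF assms, of "cube_norm p g / (cube_norm 2 g)\<^sup>2"]
  by (simp_all only: probe_def) (simp_all add: Lp_norm_nonneg)

lemma L2_norm_probe:
  assumes "in_Lp unit_cube 2 g" "0 < cube_norm 2 g"
  shows "cube_norm 2 (probe p g) = cube_norm p g / cube_norm 2 g"
  using assms Lp_probe(2)[of 2 g p] by (simp add: power2_eq_square)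

text \<open>This is why probe functions are scaled as they are: testing against the probe of $g$ recovers the
$L_p$ norm of $g$ itself.\<close>

lemma integral_probe_mult:
  assumes "0 < cube_norm 2 g"
  shows "(LINT t|unit_cube. probe p g t * g t) = cube_norm p g"
proof -
  have "(LINT t|unit_cube. probe p g t * g t)
      = cube_norm p g / (cube_norm 2 g)\<^sup>2 * (LINT t|unit_cube. g t * g t)"
    by (simp add: probe_def mult.assoc)
  then show ?thesis using assms by (simp add: L2_norm_square[symmetric])
qed

lemma finite_Psi: "finite (Psi p N F)"
  and card_Psi_le: "card (Psi p N F) \<le> N\<^sup>2"
proof -
  let ?f = "\<lambda>(i, j). probe p (\<lambda>t. F i t - F j t)"
  have sub: "Psi p N F \<subseteq> ?f ` ({1..N} \<times> {1..N})"
    by (auto simp: Psi_def)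
  then show "finite (Psi p N F)" by (rule finite_subset) simp
  have "card (Psi p N F) \<le> card (?f ` ({1..N} \<times> {1..N}))"
    using sub by (intro card_mono) auto
  also have "\<dots> \<le> card ({1..N} \<times> {1..N})" by (intro card_image_le) simp
  finally show "card (Psi p N F) \<le> N\<^sup>2" by (simp add: power2_eq_square)
qed

section \<open>The selection rule\<close>

text \<open>The standing assumptions on noise, exponents and candidate family. The selected index and the
oracle index are parameters of the lemmas instead, since most of them hold for any index.\<close>

locale selection_problem = white_noise M Z
  for M :: "'w measure" and Z :: "(real ^ 'd \<Rightarrow> real) \<Rightarrow> 'w \<Rightarrow> real" +
  fixes \<epsilon> :: real and p q :: ennreal and N :: nat
    and f :: "real ^ 'd \<Rightarrow> real" and F :: "nat \<Rightarrow> real ^ 'd \<Rightarrow> real"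
  assumes eps: "0 < \<epsilon>" "\<epsilon> < 1" and N: "2 \<le> N"
    and p: "1 \<le> p" and conj: "inverse p + inverse q = 1"
    and distinct: "\<And>i j. i \<in> {1..N} \<Longrightarrow> j \<in> {1..N} \<Longrightarrow> i \<noteq> j \<Longrightarrow>
      \<not> (AE t in unit_cube. F i t = F j t)"
    and f_Lp: "in_Lp unit_cube p f"
    and F_Lp: "\<And>i. i \<in> {1..N} \<Longrightarrow> in_Lp unit_cube p (F i)"
    and diff_L2_Lq: "\<And>i j. i \<in> {1..N} \<Longrightarrow> j \<in> {1..N} \<Longrightarrow>
      in_Lp unit_cube 2 (\<lambda>t. F i t - F j t) \<and> in_Lp unit_cube q (\<lambda>t. F i t - F j t)"
begin

abbreviation "Y \<equiv> observation Z \<epsilon> f"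

abbreviation "\<Psi> \<equiv> Psi p N F"

abbreviation "\<kappa> \<equiv> kappa M Z \<epsilon> \<Psi>"

lemma q: "1 \<le> q"
  using conjugate_ge_1[OF p conj] .

lemma diff_norm_pos:
  assumes "i \<in> {1..N}" "j \<in> {1..N}" "i \<noteq> j"
  shows "0 < cube_norm p (\<lambda>t. F i t - F j t)"
    and "0 < cube_norm q (\<lambda>t. F i t - F j t)"
    and "0 < cube_norm 2 (\<lambda>t. F i t - F j t)"
  using distinct[OF assms] diff_L2_Lq[OF assms(1,2)] Lp_diff(1)[OF p F_Lp F_Lp] assms p q
  by (auto intro!: Lp_norm_pos)

lemma Psi_nonempty: "\<Psi> \<noteq> {}"
proof -
  have "probe p (\<lambda>t. F 1 t - F 2 t) \<in> \<Psi>"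
    unfolding Psi_def using N by (intro CollectI exI[of _ 1] exI[of _ 2]) auto
  then show ?thesis by blast
qed

lemma Psi_L2_Lq:
  assumes "\<psi> \<in> \<Psi>"
  shows "in_Lp unit_cube 2 \<psi>" "0 < cube_norm 2 \<psi>" "in_Lp unit_cube q \<psi>" "0 < cube_norm q \<psi>"
proof -
  from assms obtain i j where ij: "i \<in> {1..N}" "j \<in> {1..N}" "i \<noteq> j"
    and \<psi>: "\<psi> = probe p (\<lambda>t. F i t - F j t)"
    by (auto simp: Psi_def)
  have two: "(1::ennreal) \<le> 2" by simp
  note diff = diff_L2_Lq[OF ij(1,2), THEN conjunct1] diff_L2_Lq[OF ij(1,2), THEN conjunct2]
  note pos = diff_norm_pos[OF ij]
  show "in_Lp unit_cube 2 \<psi>" "in_Lp unit_cube q \<psi>"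
    unfolding \<psi> by (rule Lp_probe(1)[OF two diff(1)], rule Lp_probe(1)[OF q diff(2)])
  show "0 < cube_norm 2 \<psi>" "0 < cube_norm q \<psi>"
    unfolding \<psi> Lp_probe(2)[OF two diff(1)] Lp_probe(2)[OF q diff(2)] using pos by simp_all
qed

text \<open>The statistic of a candidate is a deterministic bias plus noise. Hoelder's inequality supplies the
integrability needed to merge the two integrals.\<close>

lemma Delta_eq:
  assumes \<psi>: "in_Lp unit_cube q \<psi>" and h: "in_Lp unit_cube p h"
  shows "Delta Y h \<psi> \<omega> = (LINT t|unit_cube. (f t - h t) * \<psi> t) + \<epsilon> * Z \<psi> \<omega>"
  using Hoelder(1)[OF p conj f_Lp \<psi>] Hoelder(1)[OF p conj h \<psi>]
  by (simp add: Delta_def observation_def left_diff_distrib) (simp add: mult.commute)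

text \<open>On the event that the noise stays below the level $k$, subtracting $\<epsilon> k \|\psi\|_2$ removes
it, and what remains, the bias divided by $\|\psi\|_q$, is at most the $L_p$ distance to the signal
by Hoelder's inequality.\<close>

lemma Mhat_le:
  assumes h: "in_Lp unit_cube p h"
    and small: "\<And>\<psi>. \<psi> \<in> \<Psi> \<Longrightarrow> \<bar>Z \<psi> \<omega>\<bar> \<le> k * cube_norm 2 \<psi>"
  shows "Mhat Y \<epsilon> q k \<Psi> h \<omega> \<le> cube_norm p (\<lambda>t. f t - h t)"
proof -
  have "1 / cube_norm q \<psi> * (\<bar>Delta Y h \<psi> \<omega>\<bar> - \<epsilon> * k * cube_norm 2 \<psi>)
      \<le> cube_norm p (\<lambda>t. f t - h t)" if \<psi>: "\<psi> \<in> \<Psi>" for \<psi>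
  proof -
    have "\<bar>Delta Y h \<psi> \<omega>\<bar> \<le> \<bar>LINT t|unit_cube. (f t - h t) * \<psi> t\<bar> + \<epsilon> * \<bar>Z \<psi> \<omega>\<bar>"
      using eps Delta_eq[OF Psi_L2_Lq(3)[OF \<psi>] h, of \<omega>]
        abs_triangle_ineq[of "LINT t|unit_cube. (f t - h t) * \<psi> t" "\<epsilon> * Z \<psi> \<omega>"]
      by (simp add: abs_mult)
    also have "\<dots> \<le> cube_norm p (\<lambda>t. f t - h t) * cube_norm q \<psi> + \<epsilon> * (k * cube_norm 2 \<psi>)"
      using Hoelder(2)[OF p conj Lp_diff(1)[OF p f_Lp h] Psi_L2_Lq(3)[OF \<psi>]] small[OF \<psi>] eps
      by (intro add_mono mult_left_mono) auto
    finally show ?thesis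
      using Psi_L2_Lq(4)[OF \<psi>] by (simp add: field_simps)
  qed
  then show ?thesis
    unfolding Mhat_def using Psi_nonempty by (intro Max.boundedI finite_imageI finite_Psi) auto
qed

lemma Delta_le_Mhat:
  assumes \<psi>: "\<psi> \<in> \<Psi>"
  shows "\<bar>Delta Y h \<psi> \<omega>\<bar> \<le> cube_norm q \<psi> * Mhat Y \<epsilon> q k \<Psi> h \<omega> + \<epsilon> * k * cube_norm 2 \<psi>"
proof -
  have "1 / cube_norm q \<psi> * (\<bar>Delta Y h \<psi> \<omega>\<bar> - \<epsilon> * k * cube_norm 2 \<psi>) \<le> Mhat Y \<epsilon> q k \<Psi> h \<omega>"
    unfolding Mhat_def using finite_Psi \<psi> by (intro Max_ge) auto
  then show ?thesis
    using Psi_L2_Lq(4)[OF \<psi>] by (simp add: field_simps)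
qed

lemma others_finite_nonempty: "finite ({1..N} - {j})" "{1..N} - {j} \<noteq> {}"
proof -
  have "(if j = 1 then 2 else 1) \<in> {1..N} - {j}" using N by auto
  then show "{1..N} - {j} \<noteq> {}" by blast
qed simp

lemma le_Q2:
  assumes "i \<in> {1..N} - {j}"
  shows "cube_norm p (\<lambda>t. F j t - F i t) * cube_norm q (\<lambda>t. F j t - F i t)
    / (cube_norm 2 (\<lambda>t. F j t - F i t))\<^sup>2 \<le> Q2 p q N F j"
  unfolding Q2_def using assms by (intro Max_ge) auto

lemma le_Q3:
  assumes "i \<in> {1..N} - {j}"
  shows "cube_norm p (\<lambda>t. F j t - F i t) / cube_norm 2 (\<lambda>t. F j t - F i t) \<le> Q3 p N F j"
  unfolding Q3_def using assms by (intro Max_ge) auto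

lemma Q_nonneg: "0 \<le> Q2 p q N F j" "0 \<le> Q3 p N F j"
proof -
  obtain i where i: "i \<in> {1..N} - {j}" using others_finite_nonempty by blast
  show "0 \<le> Q2 p q N F j"
    by (rule order_trans[OF _ le_Q2[OF i]]) (simp add: Lp_norm_nonneg)
  show "0 \<le> Q3 p N F j"
    by (rule order_trans[OF _ le_Q3[OF i]]) (simp add: Lp_norm_nonneg)
qed

text \<open>The deterministic core. The probe $\psi$ of $F_a - F_b$ turns $\|F_a - F_b\|_p$ into a difference of
two statistics. Both criteria are at most $\|F_a - f\|_p$, that of $b$ because $b$ was preferred to
$a$, so each statistic is at most $\|\psi\|_q \|F_a - f\|_p + \<epsilon> k \|\psi\|_2$, and the norms of
$\psi$ are the quantities under the maxima that define $Q_2$ and $Q_3$.\<close>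

lemma selection_oracle_inequality:
  assumes a: "a \<in> {1..N}" and b: "b \<in> {1..N}"
    and sel: "Mhat Y \<epsilon> q k \<Psi> (F b) \<omega> \<le> Mhat Y \<epsilon> q k \<Psi> (F a) \<omega>"
    and small: "\<And>\<psi>. \<psi> \<in> \<Psi> \<Longrightarrow> \<bar>Z \<psi> \<omega>\<bar> \<le> k * cube_norm 2 \<psi>" and k: "0 \<le> k"
  shows "cube_norm p (\<lambda>t. F b t - f t)
    \<le> (2 * Q2 p q N F a + 1) * cube_norm p (\<lambda>t. F a t - f t) + 2 * Q3 p N F a * \<epsilon> * k"
proof (cases "b = a")
  case True
  have "0 \<le> 2 * Q2 p q N F a * cube_norm p (\<lambda>t. F a t - f t)" "0 \<le> 2 * Q3 p N F a * \<epsilon> * k"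
    using Q_nonneg[of a] eps k by (auto simp: Lp_norm_nonneg)
  then show ?thesis using True by (simp add: distrib_right)
next
  case False
  let ?g = "\<lambda>t. F a t - F b t"
  let ?e = "cube_norm p (\<lambda>t. F a t - f t)"
  define \<psi> where "\<psi> = probe p ?g"
  have \<psi>: "\<psi> \<in> \<Psi>" unfolding Psi_def \<psi>_def using a b False by blast
  note Fa = F_Lp[OF a] and Fb = F_Lp[OF b]
  have pos: "0 < cube_norm 2 ?g" using diff_norm_pos[OF a b] False by auto
  have Ma: "Mhat Y \<epsilon> q k \<Psi> (F a) \<omega> \<le> ?e"
    using Mhat_le[OF Fa small] by (simp add: Lp_norm_minus_commute[of _ _ f])
  have Delta_le: "\<bar>Delta Y (F i) \<psi> \<omega>\<bar> \<le> cube_norm q \<psi> * ?e + \<epsilon> * k * cube_norm 2 \<psi>"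
    if "Mhat Y \<epsilon> q k \<Psi> (F i) \<omega> \<le> ?e" for i
  proof -
    have "cube_norm q \<psi> * Mhat Y \<epsilon> q k \<Psi> (F i) \<omega> \<le> cube_norm q \<psi> * ?e"
      using that by (intro mult_left_mono) (auto simp: Lp_norm_nonneg)
    then show ?thesis using Delta_le_Mhat[OF \<psi>, of "F i" \<omega> k] by linarith
  qed
  have "cube_norm p ?g = (LINT t|unit_cube. \<psi> t * ?g t)"
    using integral_probe_mult[OF pos, of p] by (simp add: \<psi>_def)
  also have "\<dots> = Delta Y (F b) \<psi> \<omega> - Delta Y (F a) \<psi> \<omega>"
    using Hoelder(1)[OF p conj Fa Psi_L2_Lq(3)[OF \<psi>]] Hoelder(1)[OF p conj Fb Psi_L2_Lq(3)[OF \<psi>]]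
    by (simp add: Delta_def right_diff_distrib mult.commute[of "\<psi> _"])
  also have "\<dots> \<le> 2 * (cube_norm q \<psi> * ?e + \<epsilon> * k * cube_norm 2 \<psi>)"
    using Delta_le[OF Ma, THEN abs_le_D2] Delta_le[OF order_trans[OF sel Ma], THEN abs_le_D1]
    by simp
  also have "\<dots> \<le> 2 * (Q2 p q N F a * ?e + \<epsilon> * k * Q3 p N F a)"
  proof -
    have "cube_norm q \<psi> \<le> Q2 p q N F a"
      using le_Q2[of b a] b False Lp_probe(2)[OF q, of ?g p] diff_L2_Lq[OF a b] by (simp add: \<psi>_def)
    moreover have "cube_norm 2 \<psi> \<le> Q3 p N F a"
      using le_Q3[of b a] b False L2_norm_probe[OF _ pos, of p] diff_L2_Lq[OF a b] by (simp add: \<psi>_def)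
    ultimately show ?thesis
      using eps k by (intro mult_left_mono add_mono mult_right_mono) (auto simp: Lp_norm_nonneg)
  qed
  finally have gap: "cube_norm p ?g \<le> 2 * (Q2 p q N F a * ?e + \<epsilon> * k * Q3 p N F a)" .
  have "cube_norm p (\<lambda>t. F b t - f t) = cube_norm p (\<lambda>t. (F a t - f t) - ?g t)"
    by (simp add: algebra_simps)
  also have "\<dots> \<le> ?e + cube_norm p ?g"
    by (intro Lp_diff p Fa Fb f_Lp)
  finally show ?thesis using gap by (simp add: algebra_simps)
qed

text \<open>The oracle inequality is used off the event that the normalised noise reaches $\<kappa>$; on this event,
of probability at most $\<epsilon>$, the error is bounded by $2 L$.\<close>

lemma selection_risk_bound:
  assumes ihat: "ihat \<in> measurable M (count_space {1..N})"
    and sel: "\<And>\<omega>. \<omega> \<in> space M \<Longrightarrow>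
      Mhat Y \<epsilon> q \<kappa> \<Psi> (F (ihat \<omega>)) \<omega> \<le> Mhat Y \<epsilon> q \<kappa> \<Psi> (F a) \<omega>"
    and a: "a \<in> {1..N}"
    and L: "cube_norm p f \<le> L" "\<And>i. i \<in> {1..N} \<Longrightarrow> cube_norm p (F i) \<le> L"
  shows "risk M p (\<lambda>\<omega>. F (ihat \<omega>)) f
    \<le> (2 * Q2 p q N F a + 1) * cube_norm p (\<lambda>t. F a t - f t)
      + 2 * Q3 p N F a * \<epsilon> * sqrt (2 * ln ((real N)\<^sup>2 / \<epsilon>)) + 2 * L * \<epsilon>"
proof -
  define A where "A = {\<omega> \<in> space M. \<kappa> \<le> (MAX \<psi>\<in>\<Psi>. \<bar>Z \<psi> \<omega>\<bar> / cube_norm 2 \<psi>)}"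
  define B where "B = (2 * Q2 p q N F a + 1) * cube_norm p (\<lambda>t. F a t - f t)
      + 2 * Q3 p N F a * \<epsilon> * sqrt (2 * ln ((real N)\<^sup>2 / \<epsilon>))"
  define R where "R = (\<lambda>\<omega>. cube_norm p (\<lambda>t. F (ihat \<omega>) t - f t))"
  have "real (card \<Psi>) \<le> (real N)\<^sup>2"
    using card_Psi_le[of p N F] by (simp flip: of_nat_power)
  note \<kappa> = kappa_quantile[OF finite_Psi Psi_nonempty this Psi_L2_Lq(1,2) eps]
  have A_meas: "A \<in> sets M"
  proof -
    have "(\<lambda>\<omega>. MAX \<psi>\<in>\<Psi>. \<bar>Z \<psi> \<omega>\<bar> / cube_norm 2 \<psi>) \<in> borel_measurable M"
      using finite_Psi Psi_nonempty Z_measurable[OF Psi_L2_Lq(1)]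
      by (intro borel_measurable_Max) auto
    then show ?thesis unfolding A_def by measurable
  qed
  have ihat_in: "ihat \<omega> \<in> {1..N}" if "\<omega> \<in> space M" for \<omega>
    using measurable_space[OF ihat that] by simp
  have L0: "0 \<le> L" using L(1) Lp_norm_nonneg[of unit_cube p f] by linarith
  have B0: "0 \<le> B"
  proof -
    (* the square root lies above the positive level \<kappa> *)
    have "0 \<le> ln ((real N)\<^sup>2 / \<epsilon>)"
      using real_sqrt_lt_0_iff[of "2 * ln ((real N)\<^sup>2 / \<epsilon>)"] \<kappa>(1,3) by linarith
    then show ?thesis using Q_nonneg[of a] eps by (auto simp: B_def Lp_norm_nonneg)
  qed
  have R_le_2L: "R \<omega> \<le> 2 * L" if "\<omega> \<in> space M" for \<omega>
    using Lp_diff(2)[OF p F_Lp[OF ihat_in[OF that]] f_Lp] L(1) L(2)[OF ihat_in[OF that]]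
    unfolding R_def by linarith
  have pw: "R \<omega> \<le> B + 2 * L * indicator A \<omega>" if \<omega>: "\<omega> \<in> space M" for \<omega>
  proof (cases "\<omega> \<in> A")
    case True
    then show ?thesis using R_le_2L[OF \<omega>] B0 by simp
  next
    case False
    have small: "\<bar>Z \<psi> \<omega>\<bar> \<le> \<kappa> * cube_norm 2 \<psi>" if \<psi>: "\<psi> \<in> \<Psi>" for \<psi>
    proof -
      have "\<bar>Z \<psi> \<omega>\<bar> / cube_norm 2 \<psi> \<le> (MAX \<psi>\<in>\<Psi>. \<bar>Z \<psi> \<omega>\<bar> / cube_norm 2 \<psi>)"
        using finite_Psi \<psi> by (intro Max_ge) auto
      also have "\<dots> \<le> \<kappa>" using False \<omega> by (simp add: A_def)
      finally show ?thesis using Psi_L2_Lq(2)[OF \<psi>] by (simp add: divide_le_eq)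
    qed
    have "R \<omega> \<le> (2 * Q2 p q N F a + 1) * cube_norm p (\<lambda>t. F a t - f t) + 2 * Q3 p N F a * \<epsilon> * \<kappa>"
      unfolding R_def
      by (rule selection_oracle_inequality[OF a ihat_in[OF \<omega>] sel[OF \<omega>] small]) (use \<kappa>(1) in auto)
    also have "\<dots> \<le> B"
      unfolding B_def using \<kappa>(3) Q_nonneg[of a] eps by (intro add_left_mono mult_left_mono) auto
    finally show ?thesis using False by simp
  qed
  have "(\<lambda>i. cube_norm p (\<lambda>t. F i t - f t)) \<in> measurable (count_space {1..N}) borel" by simp
  from measurable_compose[OF ihat this] have "R \<in> borel_measurable M" by (simp add: R_def)
  then have int_R: "integrable M R"
    using R_le_2L by (intro integrable_const_bound[of _ "2 * L"] AE_I2) (auto simp: R_def Lp_norm_nonneg)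
  have "risk M p (\<lambda>\<omega>. F (ihat \<omega>)) f = expectation R" by (simp add: risk_def R_def)
  also have "\<dots> \<le> expectation (\<lambda>\<omega>. B + 2 * L * indicator A \<omega>)"
    using A_meas pw by (intro integral_mono int_R) (auto simp: emeasure_eq_measure)
  also have "\<dots> = B + 2 * L * prob A"
    using A_meas by (simp add: emeasure_eq_measure prob_space sets.Int_space_eq2)
  also have "\<dots> \<le> B + 2 * L * \<epsilon>"
    using \<kappa>(2) L0 by (intro add_left_mono mult_left_mono) (auto simp: A_def)
  finally show ?thesis by (simp add: B_def)
qed

end

section \<open>The risk bound\<close>

theorem corollary2:
  fixes M :: "'w measure"
    and Z :: "(real ^ 'd \<Rightarrow> real) \<Rightarrow> 'w \<Rightarrow> real"
    and f :: "real ^ 'd \<Rightarrow> real"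
    and F :: "nat \<Rightarrow> real ^ 'd \<Rightarrow> real"
    and \<epsilon> L :: real and p q :: ennreal
    and N istar :: nat and ihat :: "'w \<Rightarrow> nat"
  assumes "white_noise M Z"
    and "0 < \<epsilon>" "\<epsilon> < 1"
    and "N \<ge> 2"
    and "p \<ge> 1" and "inverse p + inverse q = 1"
    and distinct: "\<And>i j. i \<in> {1..N} \<Longrightarrow> j \<in> {1..N} \<Longrightarrow> i \<noteq> j \<Longrightarrow>
      \<not> (AE t in unit_cube. F i t = F j t)"
    and "in_Lp unit_cube p f"
    and "\<And>i. i \<in> {1..N} \<Longrightarrow> in_Lp unit_cube p (F i)"
    and "L = Max (insert (cube_norm p f) ((\<lambda>i. cube_norm p (F i)) ` {1..N}))"
    and finite_norms: "\<And>i j. i \<in> {1..N} \<Longrightarrow> j \<in> {1..N} \<Longrightarrow>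
      in_Lp unit_cube 2 (\<lambda>t. F i t - F j t) \<and> in_Lp unit_cube q (\<lambda>t. F i t - F j t)"
    and ihat_measurable: "ihat \<in> measurable M (count_space {1..N})"
    and ihat: "\<And>\<omega>. \<omega> \<in> space M \<Longrightarrow>
      is_arg_min
        (\<lambda>i. Mhat (observation Z \<epsilon> f) \<epsilon> q (kappa M Z \<epsilon> (Psi p N F)) (Psi p N F) (F i) \<omega>)
        (\<lambda>i. i \<in> {1..N}) (ihat \<omega>)"
    and istar: "is_arg_min (\<lambda>i. cube_norm p (\<lambda>t. f t - F i t)) (\<lambda>i. i \<in> {1..N}) istar"
  shows "risk M p (\<lambda>\<omega>. F (ihat \<omega>)) f
    \<le> (2 * Q2 p q N F istar + 1) * (MIN i\<in>{1..N}. cube_norm p (\<lambda>t. F i t - f t))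
      + 2 * Q3 p N F istar * \<epsilon> * sqrt (2 * ln ((real N)\<^sup>2 / \<epsilon>)) + 2 * L * \<epsilon>"
proof -
  interpret selection_problem M Z \<epsilon> p q N f F
    by (rule selection_problem.intro[OF assms(1)]) (unfold_locales; use assms in blast)
  have istar_in: "istar \<in> {1..N}"
    and istar_min: "\<And>i. i \<in> {1..N} \<Longrightarrow>
      cube_norm p (\<lambda>t. F istar t - f t) \<le> cube_norm p (\<lambda>t. F i t - f t)"
    using istar by (auto simp: is_arg_min_linorder Lp_norm_minus_commute[of _ _ f])
  have "(MIN i\<in>{1..N}. cube_norm p (\<lambda>t. F i t - f t)) = cube_norm p (\<lambda>t. F istar t - f t)"
    using istar_in istar_min by (intro Min_eqI) auto
  moreover have "cube_norm p f \<le> L" "\<And>i. i \<in> {1..N} \<Longrightarrow> cube_norm p (F i) \<le> L"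
    unfolding assms(10) by (rule Max_ge; simp)+
  moreover have "\<And>\<omega>. \<omega> \<in> space M \<Longrightarrow>
      Mhat Y \<epsilon> q \<kappa> \<Psi> (F (ihat \<omega>)) \<omega> \<le> Mhat Y \<epsilon> q \<kappa> \<Psi> (F istar) \<omega>"
    using ihat istar_in by (auto simp: is_arg_min_linorder)
  ultimately show ?thesis
    using selection_risk_bound[OF ihat_measurable _ istar_in] by presburger
qed

end
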